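(* Let $k,m,n$ be positive integers with $m\le k$ and $n\ge k-m+1$. For each $i\ge0$, the number of elements of degree $i$ in $L^k(m,n)$ (i.e. of $\lambda\in L^k(m,n)$ with $|\lambda|=i$) is the coefficient of $q^i$ in $$\begin{bmatrix} k+1 \\ m \end{bmatrix}_q+q^{k+1}\,\frac{1-q^{m(n-k+m-1)}}{1-q^m}\begin{bmatrix} k \\ m-1 \end{bmatrix}_q .$$
   Context: Fix an integer $k\ge1$. A partition $\lambda=(\lambda_1\ge\dots\ge\lambda_\ell>0)$ is a finite (possibly empty) non-increasing sequence of positive integers, $|\lambda|=\sum_i\lambda_i$ is its degree, $\ell(\lambda)$ is the number of parts, and $\lambda_i=0$ for $i>\ell(\lambda)$. Its diagram is the set of cells $(i,j)$ with $1\le j\le\lambda_i$ (row $i$, column $j$; row 1 is the lowest row, and "above" means larger row index). $\lambda\subseteq\mu$ means $\lambda_i\le\mu_i$ for all $i$. A partition is $k$-bounded if $\lambda_1\le k$; $\mathcal P^k$ is the set of $k$-bounded partitions. $(m^n)$ is the partition with $n$ parts equal to $m$. The Gaussian polynomial is $\begin{bmatrix} a+b \\ b \end{bmatrix}_q=\dfrac{(1-q^{a+1})\cdots(1-q^{a+b})}{(1-q)\cdots(1-q^{b})}$ for $a,b\ge0$. For partitions $\rho\subseteq\gamma$, the skew diagram $\gamma/\rho$ is $\{(i,j):\rho_i<j\le\gamma_i\}$; the squares of $\rho$ are said to lie below $\gamma/\rho$. For a square $(i,j)\in\gamma$ (possibly in $\rho$), its hook-length in $\gamma/\rho$ is the number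 of cells of $\gamma/\rho$ of the form $(i,j')$ with $j'\ge j$ or $(i',j)$ with $i'\ge i$. For $\lambda\in\mathcal P^k$, the $k$-skew diagram $\lambda/^k$ is the unique skew diagram such that (i) row $i$ has $\lambda_i$ cells, (ii) no cell of the diagram has hook-length exceeding $k$, (iii) every square below the diagram has hook-length exceeding $k$. The column lengths of $\lambda/^k$ form a $k$-bounded partition, called the $k$-conjugate $\lambda^{\omega_k}$. For $\lambda,\mu\in\mathcal P^k$ write $\lambda\prec\!\!\cdot\,\mu$ when $\lambda\subseteq\mu$, $\lambda^{\omega_k}\subseteq\mu^{\omega_k}$ and $|\mu|-|\lambda|=1$. The partial order $\preceq$ on $\mathcal P^k$ is the reflexive-transitive closure of $\prec\!\!\cdot$; the resulting poset is $Y^k$. For $1\le m\le k$ and $n\ge1$, $L^k(m,n)=\{\mu\in\mathcal P^k:\mu\preceq(m^n)\}$ is the principal order ideal of $Y^k$ generated by $(m^n)$. *)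

theory Defs
  imports Complex_Main "HOL-Computational_Algebra.Formal_Power_Series"
begin

definition is_partition :: "nat list \<Rightarrow> bool" where
  "is_partition lam \<longleftrightarrow> sorted_wrt (\<ge>) lam \<and> (\<forall>x\<in>set lam. 0 < x)"

(* Parts are indexed from 1, as are the rows and columns of diagrams; part lam 0 is irrelevant. *)
definition part :: "nat list \<Rightarrow> nat \<Rightarrow> nat" where
  "part lam i = (if 1 \<le> i \<and> i \<le> length lam then lam ! (i - 1) else 0)"

definition diagram :: "nat list \<Rightarrow> (nat \<times> nat) set" where
  "diagram lam = {(i, j). 1 \<le> i \<and> 1 \<le> j \<and> j \<le> part lam i}"

definition contained :: "nat list \<Rightarrow> nat list \<Rightarrow> bool" where
  "contained lam mu \<longleftrightarrow> (\<forall>i\<ge>1. part lam i \<le> part mu i)"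

definition bounded_partitions :: "nat \<Rightarrow> nat list set" where
  "bounded_partitions k = {lam. is_partition lam \<and> part lam 1 \<le> k}"

definition skew_diagram :: "nat list \<Rightarrow> nat list \<Rightarrow> (nat \<times> nat) set" where
  "skew_diagram gam rho = {(i, j). 1 \<le> i \<and> part rho i < j \<and> j \<le> part gam i}"

(* The square (i, j) itself is counted only if it lies in the skew diagram. *)
definition hook_length :: "nat list \<Rightarrow> nat list \<Rightarrow> nat \<times> nat \<Rightarrow> nat" where
  "hook_length gam rho = (\<lambda>(i, j).
     card {(i', j') \<in> skew_diagram gam rho. (i' = i \<and> j \<le> j') \<or> (j' = j \<and> i \<le> i')})"

definition is_k_skew :: "nat \<Rightarrow> nat list \<Rightarrow> nat list \<Rightarrow> nat list \<Rightarrow> bool" where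
  "is_k_skew k lam gam rho \<longleftrightarrow>
     is_partition gam \<and> is_partition rho \<and> contained rho gam \<and>
     (\<forall>i\<ge>1. card {j. (i, j) \<in> skew_diagram gam rho} = part lam i) \<and>
     (\<forall>c\<in>skew_diagram gam rho. hook_length gam rho c \<le> k) \<and>
     (\<forall>c\<in>diagram rho. k < hook_length gam rho c)"

(* The k-skew diagram is represented by the pair (gam, rho), which the diagram determines:
   for a partition lam the rows that have cells are rows 1, ..., length lam, and gam has no
   further rows, since the squares in its top row would lie in rho with hook-length 0. *)
definition k_skew :: "nat \<Rightarrow> nat list \<Rightarrow> nat list \<times> nat list" where
  "k_skew k lam = (THE (gam, rho). is_k_skew k lam gam rho)"

definition k_conjugate :: "nat \<Rightarrow> nat list \<Rightarrow> nat list" where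
  "k_conjugate k lam = (let (gam, rho) = k_skew k lam in
     map (\<lambda>j. card {i. (i, j) \<in> skew_diagram gam rho}) [1..<Suc (part gam 1)])"

definition k_cover :: "nat \<Rightarrow> nat list \<Rightarrow> nat list \<Rightarrow> bool" where
  "k_cover k lam mu \<longleftrightarrow>
     lam \<in> bounded_partitions k \<and> mu \<in> bounded_partitions k \<and>
     contained lam mu \<and> contained (k_conjugate k lam) (k_conjugate k mu) \<and>
     sum_list mu = Suc (sum_list lam)"

definition k_le :: "nat \<Rightarrow> nat list \<Rightarrow> nat list \<Rightarrow> bool" where
  "k_le k = (k_cover k)\<^sup>*\<^sup>*"

definition L_ideal :: "nat \<Rightarrow> nat \<Rightarrow> nat \<Rightarrow> nat list set" where
  "L_ideal k m n = {mu \<in> bounded_partitions k. k_le k mu (replicate n m)}"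

(* Top entry N = a + b, bottom entry b, meant for b <= N. The denominator has constant
   coefficient 1, hence is a unit of the power series ring, and the division is exact. *)
definition gaussian :: "nat \<Rightarrow> nat \<Rightarrow> rat fps" where
  "gaussian N b = (\<Prod>i=1..b. 1 - fps_X ^ (N - b + i)) / (\<Prod>i=1..b. 1 - fps_X ^ i)"

end

theory Submission
  imports Defs
begin

text \<open>
  Put p = k + 1 - m. The degree count rests on an explicit description of the ideal: a partition
  lies below the rectangle (m^n) exactly if it fits inside that rectangle and at most p of its
  parts are smaller than m. Such partitions are called near rectangles here, and the description
  is lemma \<open>L_ideal_eq_near_rectangles\<close>.

  The k-skew diagram of a partition is built from the top row downwards: each new row is pushed to
  the right just far enough for its first hook-length to be at most k. This proves existence, and
  it gives a recursion for the column heights, that is, for the k-conjugate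
  (\<open>part_k_conjugate\<close>). For a near rectangle the recursion can be solved. The rows shorter than m
  are not moved at all, while a row of length m starts at the first column of height less than p,
  so no column ever grows beyond p. The effect is that every ordinary column of the partition is
  chopped into pieces of height p and one remainder, and the k-conjugate is the sorted list of
  all the pieces. Counting the pieces of height at least v turns this into the formula of
  \<open>col_heights_near_rectangle\<close>, in which every term is monotone in an ordinary column length.

  Hence, among near rectangles, ordinary containment already implies containment of the
  k-conjugates, and any near rectangle other than (m^n) can be enlarged by one cell to another
  near rectangle, so all of them lie below (m^n). Conversely, a cover cannot leave the near
  rectangles downwards: if p + 1 parts are smaller than m, then the top p + 1 rows of the k-skew
  diagram all meet the first column, whereas the columns of a near rectangle have height at most p
  (\<open>near_rectangle_of_cover\<close>).

  It remains to count near rectangles by degree. Those with at most p parts are all the partitions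
  in a p by m box, counted by the first Gaussian polynomial. Those with p + j + 1 parts start with
  j + 1 parts equal to m, followed by exactly p positive parts of size at most m; removing one cell
  from each of the latter leaves a partition in a p by (m - 1) box, so they contribute
  q^(k + 1 + j m) times the second Gaussian polynomial. Summing over j gives the geometric series
  of the theorem.
\<close>

section \<open>Partitions, parts and columns\<close>

lemma part_Nil [simp]: "part [] i = 0"
  by (simp add: part_def)

lemma part_Cons_1 [simp]: "part (x # xs) (Suc 0) = x"
  by (simp add: part_def)

lemma part_Cons_Suc: "1 \<le> i \<Longrightarrow> part (x # xs) (Suc i) = part xs i"
  by (cases i) (auto simp: part_def)

lemma part_gt_length: "length xs < i \<Longrightarrow> part xs i = 0"
  by (simp add: part_def)

lemma part_pos: "is_partition xs \<Longrightarrow> 1 \<le> i \<Longrightarrow> i \<le> length xs \<Longrightarrow> 0 < part xs i"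
  by (auto simp: part_def is_partition_def)

lemma part_le_bound: "set xs \<subseteq> {..b} \<Longrightarrow> part xs i \<le> b"
  by (auto simp: part_def subset_iff)

lemma is_partition_Cons:
  "is_partition (x # xs) \<longleftrightarrow> 0 < x \<and> set xs \<subseteq> {..x} \<and> is_partition xs"
  by (auto simp: is_partition_def)

lemma is_partition_append:
  "is_partition (xs @ ys) \<longleftrightarrow>
     is_partition xs \<and> is_partition ys \<and> (\<forall>x\<in>set xs. \<forall>y\<in>set ys. y \<le> x)"
  by (auto simp: is_partition_def sorted_wrt_append)

lemma is_partition_replicate: "0 < m \<Longrightarrow> is_partition (replicate n m)"
  by (induction n) (auto simp: is_partition_Cons is_partition_def)

lemma bounded_partitions_eq:
  "bounded_partitions k = {xs. is_partition xs \<and> set xs \<subseteq> {..k}}"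
proof -
  have "part xs 1 \<le> k \<longleftrightarrow> set xs \<subseteq> {..k}" if "is_partition xs" for xs
    using that by (cases xs) (auto simp: is_partition_Cons)
  then show ?thesis
    by (auto simp: bounded_partitions_def)
qed

lemma partition_eqI:
  assumes "is_partition xs" and "is_partition ys" and "\<And>i. 1 \<le> i \<Longrightarrow> part xs i = part ys i"
  shows "xs = ys"
proof -
  have le: "length us \<le> length vs"
    if "is_partition us" and "\<And>i. 1 \<le> i \<Longrightarrow> part us i = part vs i" for us vs
  proof (rule ccontr)
    assume "\<not> length us \<le> length vs"
    then have "0 < part us (length us)" and "part vs (length us) = 0" and "1 \<le> length us"
      using that(1) by (auto intro!: part_pos simp: part_gt_length)
    then show False using that(2) by simp
  qed
  have "length xs = length ys"
    using le[of xs ys] le[of ys xs] assms by simp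
  moreover have "xs ! i = ys ! i" if "i < length xs" for i
    using assms(3)[of "Suc i"] that calculation by (simp add: part_def)
  ultimately show ?thesis by (rule nth_equalityI)
qed

definition column :: "nat list \<Rightarrow> nat \<Rightarrow> nat" where
  "column xs t = length (filter (\<lambda>x. t \<le> x) xs)"

lemma column_le_length: "column xs t \<le> length xs"
  by (simp add: column_def)

text \<open>
  Column t reaches row v exactly if row v reaches column t. The bound on v matters for t = 0, where
  0 \<le> part xs v also holds beyond the last row.
\<close>

lemma le_column_iff:
  assumes "is_partition xs" and "1 \<le> v"
  shows "v \<le> column xs t \<longleftrightarrow> t \<le> part xs v \<and> v \<le> length xs"
  using assms
proof (induction xs arbitrary: v)
  case Nil
  then show ?case by (simp add: column_def)
next
  case (Cons x xs)
  show ?case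
  proof (cases "t \<le> x")
    case True
    show ?thesis
    proof (cases "v = 1")
      case False
      then obtain w where w: "v = Suc w" "1 \<le> w" using Cons.prems(2) by (cases v) auto
      then show ?thesis
        using True Cons.IH[of w] Cons.prems by (simp add: column_def part_Cons_Suc is_partition_Cons)
    qed (use True in \<open>simp add: column_def\<close>)
  next
    case False
    have "column (x # xs) t = 0"
      using False Cons.prems(1) by (auto simp: column_def is_partition_Cons filter_empty_conv)
    moreover have "part (x # xs) v \<le> x"
      using Cons.prems(1) by (intro part_le_bound) (auto simp: is_partition_Cons)
    ultimately show ?thesis using False Cons.prems(2) by simp
  qed
qed

lemma contained_length:
  assumes "is_partition xs" and "contained xs ys"
  shows "length xs \<le> length ys"
proof (rule ccontr)
  assume "\<not> length xs \<le> length ys"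
  then have "0 < part xs (length xs)" "part ys (length xs) = 0" "1 \<le> length xs"
    using assms(1) by (auto intro!: part_pos simp: part_gt_length)
  then show False using assms(2) by (force simp: contained_def)
qed

lemma contained_column:
  assumes "is_partition xs" and "is_partition ys" and "contained xs ys"
  shows "column xs t \<le> column ys t"
proof (cases "column xs t = 0")
  case False
  let ?v = "column xs t"
  have "t \<le> part xs ?v" using le_column_iff[OF assms(1), of ?v t] False by simp
  also have "\<dots> \<le> part ys ?v" using assms(3) False by (simp add: contained_def)
  finally have "t \<le> part ys ?v" .
  moreover have "?v \<le> length ys"
    using contained_length[OF assms(1,3)] column_le_length[of xs t] by simp
  ultimately show ?thesis using le_column_iff[OF assms(2), of ?v t] False by simp
qed simp

section \<open>Existence and uniqueness of the k-skew diagram\<close>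

lemma finite_skew_column: "finite {i. (i, j) \<in> skew_diagram gam rho \<and> P i}"
proof (rule finite_subset)
  show "{i. (i, j) \<in> skew_diagram gam rho \<and> P i} \<subseteq> {..length gam}"
    by (auto simp: skew_diagram_def part_def split: if_splits)
qed simp

lemma finite_skew_row: "finite {j. (i, j) \<in> skew_diagram gam rho \<and> P j}"
proof (rule finite_subset)
  show "{j. (i, j) \<in> skew_diagram gam rho \<and> P j} \<subseteq> {..part gam i}"
    by (auto simp: skew_diagram_def)
qed simp

lemma hook_length_eq:
  "hook_length gam rho (i, j) =
     card {j'. (i, j') \<in> skew_diagram gam rho \<and> j \<le> j'} +
     card {i'. (i', j) \<in> skew_diagram gam rho \<and> i < i'}"
proof -
  let ?R = "{j'. (i, j') \<in> skew_diagram gam rho \<and> j \<le> j'}"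
  let ?C = "{i'. (i', j) \<in> skew_diagram gam rho \<and> i < i'}"
  have "{(i', j') \<in> skew_diagram gam rho. (i' = i \<and> j \<le> j') \<or> (j' = j \<and> i \<le> i')}
      = Pair i ` ?R \<union> (\<lambda>i'. (i', j)) ` ?C"
    by (auto simp: image_iff)
  moreover have "card (Pair i ` ?R \<union> (\<lambda>i'. (i', j)) ` ?C) = card (Pair i ` ?R) + card ((\<lambda>i'. (i', j)) ` ?C)"
    using finite_skew_row finite_skew_column by (intro card_Un_disjoint) auto
  ultimately show ?thesis
    by (simp add: hook_length_def card_image inj_on_def)
qed

lemma skew_row_card:
  assumes "1 \<le> i"
  shows "card {j. (i, j) \<in> skew_diagram gam rho} = part gam i - part rho i"
proof -
  have "{j. (i, j) \<in> skew_diagram gam rho} = {part rho i<..part gam i}"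
    using assms by (auto simp: skew_diagram_def)
  then show ?thesis by simp
qed

lemma is_k_skew_outer:
  assumes "is_k_skew k lam gam rho" and "1 \<le> i"
  shows "part gam i = part rho i + part lam i"
proof -
  have "part gam i - part rho i = part lam i"
    using assms skew_row_card[OF assms(2), of gam rho] by (simp add: is_k_skew_def)
  moreover have "part rho i \<le> part gam i"
    using assms by (simp add: is_k_skew_def contained_def)
  ultimately show ?thesis by simp
qed

text \<open>
  Once the rows above row i are fixed, so is row i. If the first diagram were less indented there,
  the square at which its row i starts would lie below the second diagram. Both diagrams have the
  same cells above that square and the same number of cells to its right, so the two hook-length
  conditions contradict each other.
\<close>

lemma is_k_skew_inner_le:
  assumes lam: "is_partition lam"
    and A: "is_k_skew k lam gam rho" and B: "is_k_skew k lam gam' rho'"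
    and i: "1 \<le> i" and above: "\<And>i'. i < i' \<Longrightarrow> part rho i' = part rho' i'"
  shows "part rho' i \<le> part rho i"
proof (rule ccontr)
  assume "\<not> part rho' i \<le> part rho i"
  define j where "j = Suc (part rho i)"
  have j: "1 \<le> j" "j \<le> part rho' i"
    using \<open>\<not> part rho' i \<le> part rho i\<close> by (auto simp: j_def)
  let ?C = "{i'. (i', j) \<in> skew_diagram gam rho \<and> i < i'}"
  have same: "{i'. (i', j) \<in> skew_diagram gam' rho' \<and> i < i'} = ?C"
    using i above is_k_skew_outer[OF A] is_k_skew_outer[OF B]
    by (auto simp: skew_diagram_def)
  have row: "{j'. (i, j') \<in> skew_diagram gam' rho' \<and> j \<le> j'} = {j'. (i, j') \<in> skew_diagram gam' rho'}"
    using j by (auto simp: skew_diagram_def)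
  have "(i, j) \<in> diagram rho'"
    using i j by (simp add: diagram_def)
  then have "k < hook_length gam' rho' (i, j)"
    using B by (simp add: is_k_skew_def)
  then have big: "k < part lam i + card ?C"
    using B i by (simp add: hook_length_eq same row is_k_skew_def)
  show False
  proof (cases "i \<le> length lam")
    case True
    have row': "{j'. (i, j') \<in> skew_diagram gam rho \<and> j \<le> j'} = {j'. (i, j') \<in> skew_diagram gam rho}"
      by (auto simp: skew_diagram_def j_def)
    have "(i, j) \<in> skew_diagram gam rho"
      using i part_pos[OF lam i True] is_k_skew_outer[OF A i] by (simp add: skew_diagram_def j_def)
    then have "hook_length gam rho (i, j) \<le> k"
      using A by (simp add: is_k_skew_def)
    then have "part lam i + card ?C \<le> k"
      using A i by (simp add: hook_length_eq row' is_k_skew_def)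
    then show False using big by simp
  next
    case False
    then have "?C = {}"
      using is_k_skew_outer[OF A] i by (auto simp: skew_diagram_def part_gt_length)
    then have "card ?C = 0" by (simp only: card.empty)
    moreover have "part lam i = 0" using False by (simp add: part_gt_length)
    ultimately show False using big by simp
  qed
qed

lemma is_k_skew_unique:
  assumes lam: "is_partition lam"
    and A: "is_k_skew k lam gam rho" and B: "is_k_skew k lam gam' rho'"
  shows "gam = gam' \<and> rho = rho'"
proof -
  define N where "N = max (length rho) (length rho')"
  have eq: "part rho i = part rho' i" if "1 \<le> i" for i
    using that
  proof (induction "Suc N - i" arbitrary: i rule: less_induct)
    case less
    show ?case
    proof (cases "i \<le> N")
      case True
      then have "part rho i' = part rho' i'" if "i < i'" for i'
        using less.hyps[of i'] less.prems that by simp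
      then show ?thesis
        using is_k_skew_inner_le[OF lam A B less.prems] is_k_skew_inner_le[OF lam B A less.prems]
        by (simp add: le_antisym)
    qed (simp add: N_def part_gt_length)
  qed
  have "rho = rho'"
    using A B eq by (intro partition_eqI) (auto simp: is_k_skew_def)
  moreover have "gam = gam'"
    using A B eq is_k_skew_outer[OF A] is_k_skew_outer[OF B]
    by (intro partition_eqI) (auto simp: is_k_skew_def)
  ultimately show ?thesis by simp
qed

text \<open>
  The indentation of a new bottom row of length x under a diagram with column heights h: the
  sum that is compared with k is the hook-length of the first cell of the row when r squares lie
  to its left.
\<close>

definition shift :: "nat \<Rightarrow> (nat \<Rightarrow> nat) \<Rightarrow> nat \<Rightarrow> nat" where
  "shift k h x = (LEAST r. x + h (Suc r) \<le> k)"

primrec col_heights :: "nat \<Rightarrow> nat list \<Rightarrow> nat \<Rightarrow> nat" where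
  "col_heights k [] = (\<lambda>_. 0)"
| "col_heights k (x # xs) =
     (\<lambda>j. col_heights k xs j +
        (if shift k (col_heights k xs) x < j \<and> j \<le> shift k (col_heights k xs) x + x then 1 else 0))"

lemma col_heights_eventually_0: "\<exists>J. \<forall>j>J. col_heights k xs j = 0"
proof (induction xs)
  case (Cons x xs)
  then obtain J where "\<forall>j>J. col_heights k xs j = 0" by blast
  then show ?case
    by (intro exI[of _ "max J (shift k (col_heights k xs) x + x)"]) simp
qed simp

lemma shift_le:
  assumes "x \<le> k"
  shows "x + col_heights k xs (Suc (shift k (col_heights k xs) x)) \<le> k"
proof -
  obtain J where "\<forall>j>J. col_heights k xs j = 0" using col_heights_eventually_0 by blast
  then have "x + col_heights k xs (Suc J) \<le> k" using assms by simp
  then show ?thesis unfolding shift_def by (rule LeastI)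
qed

lemma gt_of_le_shift:
  assumes "1 \<le> j" and "j \<le> shift k h x"
  shows "k < x + h j"
  using assms not_less_Least[of "j - 1" "\<lambda>r. x + h (Suc r) \<le> k"]
  by (cases j) (auto simp: shift_def)

text \<open>
  A new row raises the columns after its indentation r, and column r + 1 was strictly lower than
  all columns up to r, because those are the ones that violate the hook bound. So raising by one
  keeps the heights sorted.
\<close>

lemma col_heights_antimono:
  assumes "set xs \<subseteq> {..k}" and "1 \<le> i" and "i \<le> j"
  shows "col_heights k xs j \<le> col_heights k xs i"
  using assms
proof (induction xs arbitrary: i j)
  case (Cons x xs)
  let ?h = "col_heights k xs" and ?r = "shift k (col_heights k xs) x"
  have IH: "?h j \<le> ?h i" using Cons by simp
  show ?case
  proof (cases "i \<le> ?r \<and> ?r < j \<and> j \<le> ?r + x")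
    case True
    have "k < x + ?h i" using True Cons.prems by (intro gt_of_le_shift) auto
    moreover have "x + ?h (Suc ?r) \<le> k" using Cons.prems by (intro shift_le) simp
    moreover have "?h j \<le> ?h (Suc ?r)" using True Cons by simp
    ultimately show ?thesis using True by simp
  next
    case False
    then show ?thesis using IH Cons.prems(3) by auto
  qed
qed simp

text \<open>
  The list is processed from its last part, the top row. The new row is indented
  at least as far as the row above it: compared with a square to the left of that row, which has
  hook-length greater than k, the square underneath sees the same cells above it and a row that is
  at least as long.
\<close>

lemma k_skew_exists:
  assumes "is_partition xs" and "set xs \<subseteq> {..k}"
  shows "\<exists>gam rho. is_k_skew k xs gam rho \<and>
     (\<forall>j\<ge>1. card {i. (i, j) \<in> skew_diagram gam rho} = col_heights k xs j)"
  using assms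
proof (induction xs)
  case Nil
  have "is_k_skew k [] [] []"
    by (auto simp: is_k_skew_def is_partition_def contained_def skew_diagram_def diagram_def)
  moreover have "{i. (i, j) \<in> skew_diagram [] []} = {}" for j
    by (auto simp: skew_diagram_def)
  then have "card {i. (i, j) \<in> skew_diagram [] []} = col_heights k [] j" for j
    by simp
  ultimately show ?case by blast
next
  case (Cons x xs)
  let ?h = "col_heights k xs"
  define r where "r = shift k ?h x"
  obtain gam rho where K: "is_k_skew k xs gam rho"
    and H: "\<And>j. 1 \<le> j \<Longrightarrow> card {i. (i, j) \<in> skew_diagram gam rho} = ?h j"
    using Cons by (auto simp: is_partition_Cons)
  have x: "0 < x" "x \<le> k" "part xs 1 \<le> x"
    using Cons.prems part_le_bound[of xs x] by (auto simp: is_partition_Cons)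
  have parts: "is_partition gam" "is_partition rho"
    using K by (auto simp: is_k_skew_def)
  have below: "k < x + ?h j" if "1 \<le> j" "j \<le> part rho 1" for j
  proof -
    have "(1, j) \<in> diagram rho" using that by (simp add: diagram_def)
    then have "k < hook_length gam rho (1, j)" using K by (simp add: is_k_skew_def)
    also have "\<dots> \<le> card {j'. (1, j') \<in> skew_diagram gam rho} + card {i'. (i', j) \<in> skew_diagram gam rho}"
      unfolding hook_length_eq
      using finite_skew_row[of 1 gam rho "\<lambda>_. True"] finite_skew_column[of j gam rho "\<lambda>_. True"]
      by (intro add_mono card_mono) auto
    also have "\<dots> \<le> x + ?h j"
      using K H[of j] that x by (simp add: is_k_skew_def)
    finally show ?thesis .
  qed
  have rho_le: "part rho 1 \<le> r"
  proof (rule ccontr)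
    assume "\<not> part rho 1 \<le> r"
    then have "k < x + ?h (Suc r)" by (intro below) auto
    then show False using shift_le[OF x(2), of xs] by (simp add: r_def)
  qed
  \<comment> \<open>A partition list has no zero entries, so an unindented row leaves the inner partition empty.\<close>
  define rho' where "rho' = (if r = 0 then [] else r # rho)"
  define gam' where "gam' = (r + x) # gam"
  have rho_Nil: "rho = []" if "r = 0"
    using rho_le that part_pos[OF parts(2), of 1] by (cases rho) auto
  have rho'1: "part rho' (Suc 0) = r"
    by (simp add: rho'_def)
  have rho'S: "part rho' (Suc i) = part rho i" if "1 \<le> i" for i
    using that rho_Nil by (simp add: rho'_def part_Cons_Suc)
  have gam'1: "part gam' (Suc 0) = r + x"
    by (simp add: gam'_def)
  have gam'S: "part gam' (Suc i) = part gam i" if "1 \<le> i" for i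
    using that by (simp add: gam'_def part_Cons_Suc)
  have skew1: "(Suc 0, j) \<in> skew_diagram gam' rho' \<longleftrightarrow> r < j \<and> j \<le> r + x" for j
    by (simp add: skew_diagram_def rho'1 gam'1)
  have skewS: "(Suc i, j) \<in> skew_diagram gam' rho' \<longleftrightarrow> (i, j) \<in> skew_diagram gam rho" if "1 \<le> i" for i j
    using that by (simp add: skew_diagram_def rho'S gam'S)
  have skew0: "(0, j) \<notin> skew_diagram g s" for j g s
    by (simp add: skew_diagram_def)
  have col: "{i'. (i', j) \<in> skew_diagram gam' rho' \<and> Suc i < i'} = Suc ` {i'. (i', j) \<in> skew_diagram gam rho \<and> i < i'}" for i j
  proof -
    have "i' \<in> {i'. (i', j) \<in> skew_diagram gam' rho' \<and> Suc i < i'} \<longleftrightarrow>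
          i' \<in> Suc ` {i'. (i', j) \<in> skew_diagram gam rho \<and> i < i'}" for i'
      by (cases i') (auto simp: skewS)
    then show ?thesis by blast
  qed
  have hookS: "hook_length gam' rho' (Suc i, j) = hook_length gam rho (i, j)" if "1 \<le> i" for i j
    using that by (simp add: hook_length_eq col card_image skewS)
  have above: "{i'. (i', j) \<in> skew_diagram gam rho \<and> 0 < i'} = {i'. (i', j) \<in> skew_diagram gam rho}" for j
    by (auto simp: skew_diagram_def)
  have hook1: "hook_length gam' rho' (Suc 0, j) = card {j'. r < j' \<and> j' \<le> r + x \<and> j \<le> j'} + ?h j" if "1 \<le> j" for j
    using that H[of j] by (simp add: hook_length_eq col card_image above skew1 conj_assoc)
  have "is_partition rho'"
    using rho_le parts(2)
    by (auto simp: rho'_def is_partition_Cons is_partition_def[of "[]"])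
       (cases rho; force simp: is_partition_Cons)
  moreover have "part gam 1 \<le> r + x"
    using is_k_skew_outer[OF K, of 1] rho_le x by simp
  then have "is_partition gam'"
    using x parts(1) by (cases gam) (auto simp: gam'_def is_partition_Cons is_partition_def[of "[]"])
  moreover have "contained rho' gam'"
    unfolding contained_def
  proof (intro allI impI)
    fix i :: nat assume "1 \<le> i"
    then show "part rho' i \<le> part gam' i"
      using K by (cases i; cases "i = 1")
        (auto simp: rho'1 gam'1 rho'S gam'S is_k_skew_def contained_def)
  qed
  moreover have "card {j. (i, j) \<in> skew_diagram gam' rho'} = part (x # xs) i" if "1 \<le> i" for i
  proof (cases "i = 1")
    case True
    have "{j. r < j \<and> j \<le> r + x} = {r<..r + x}" by auto
    then show ?thesis using True by (simp add: skew1)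
  next
    case False
    then obtain i' where "i = Suc i'" "1 \<le> i'" using \<open>1 \<le> i\<close> by (cases i) auto
    then show ?thesis using K by (simp add: skewS part_Cons_Suc is_k_skew_def)
  qed
  moreover have "hook_length gam' rho' c \<le> k" if c: "c \<in> skew_diagram gam' rho'" for c
  proof -
    obtain i j where ij: "c = (Suc i, j)" "1 \<le> j"
      using c by (cases c; cases "fst c") (auto simp: skew_diagram_def)
    show ?thesis
    proof (cases "i = 0")
      case True
      then have j: "r < j" "j \<le> r + x" using c ij by (auto simp: skew1)
      have "{j'. r < j' \<and> j' \<le> r + x \<and> j \<le> j'} = {j..r + x}" using j by auto
      then have "card {j'. r < j' \<and> j' \<le> r + x \<and> j \<le> j'} \<le> x" using j by simp
      moreover have "?h j \<le> ?h (Suc r)"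
        using j Cons.prems(2) by (intro col_heights_antimono) auto
      ultimately have "hook_length gam' rho' c \<le> x + ?h (Suc r)"
        using True ij hook1 by simp
      then show ?thesis using shift_le[OF x(2), of xs] by (simp add: r_def)
    next
      case False
      then show ?thesis using c ij K hookS skewS by (simp add: is_k_skew_def)
    qed
  qed
  moreover have "k < hook_length gam' rho' c" if c: "c \<in> diagram rho'" for c
  proof -
    obtain i j where ij: "c = (Suc i, j)" "1 \<le> j" "j \<le> part rho' (Suc i)"
      using c by (cases c; cases "fst c") (auto simp: diagram_def)
    show ?thesis
    proof (cases "i = 0")
      case True
      then have "j \<le> r" using ij rho'1 by simp
      then have "{j'. r < j' \<and> j' \<le> r + x \<and> j \<le> j'} = {r<..r + x}" by auto
      then show ?thesis
        using True ij hook1[of j] gt_of_le_shift[of j k ?h x] \<open>j \<le> r\<close> by (simp add: r_def)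
    next
      case False
      then have "(i, j) \<in> diagram rho" using ij rho'S by (simp add: diagram_def)
      then show ?thesis using False ij K hookS by (simp add: is_k_skew_def)
    qed
  qed
  ultimately have "is_k_skew k (x # xs) gam' rho'"
    by (simp add: is_k_skew_def)
  moreover have "card {i. (i, j) \<in> skew_diagram gam' rho'} = col_heights k (x # xs) j" if j: "1 \<le> j" for j
  proof -
    let ?A = "{i'. (i', j) \<in> skew_diagram gam' rho' \<and> Suc 0 < i'}"
    have "card ?A = ?h j" using j H by (simp add: col card_image above)
    moreover have "finite ?A" by (rule finite_skew_column)
    moreover have "(i, j) \<in> skew_diagram gam' rho' \<longleftrightarrow>
        i \<in> (if r < j \<and> j \<le> r + x then insert (Suc 0) ?A else ?A)" for i
      by (cases "i = 0"; cases "i = Suc 0") (auto simp: skew0 skew1)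
    then have "{i. (i, j) \<in> skew_diagram gam' rho'} =
        (if r < j \<and> j \<le> r + x then insert (Suc 0) ?A else ?A)"
      by blast
    ultimately show ?thesis by (simp add: r_def)
  qed
  ultimately show ?case by blast
qed

lemma part_k_conjugate:
  assumes "lam \<in> bounded_partitions k" and "1 \<le> j"
  shows "part (k_conjugate k lam) j = col_heights k lam j"
proof -
  have lam: "is_partition lam" "set lam \<subseteq> {..k}"
    using assms(1) by (auto simp: bounded_partitions_eq)
  obtain gam rho where K: "is_k_skew k lam gam rho"
    and H: "\<And>j. 1 \<le> j \<Longrightarrow> card {i. (i, j) \<in> skew_diagram gam rho} = col_heights k lam j"
    using k_skew_exists[OF lam] by blast
  have "k_skew k lam = (gam, rho)"
    unfolding k_skew_def
  proof (rule the_equality)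
    fix gr assume "case gr of (gam, rho) \<Rightarrow> is_k_skew k lam gam rho"
    then show "gr = (gam, rho)"
      using is_k_skew_unique[OF lam(1) _ K] by (cases gr) simp
  qed (simp add: K)
  then have conj: "k_conjugate k lam = map (\<lambda>j. card {i. (i, j) \<in> skew_diagram gam rho}) [1..<Suc (part gam 1)]"
    by (simp add: k_conjugate_def)
  have part_map: "part (map f [1..<Suc N]) j = (if j \<le> N then f j else 0)" for f and N :: nat
    using assms(2) by (auto simp: part_def simp del: upt_Suc)
  show ?thesis
  proof (cases "j \<le> part gam 1")
    case True
    then show ?thesis using H[OF assms(2)] unfolding conj part_map by simp
  next
    case False
    have "part gam i \<le> part gam 1" for i
      using K by (cases gam) (auto simp: is_k_skew_def is_partition_Cons intro!: part_le_bound)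
    then have "{i. (i, j) \<in> skew_diagram gam rho} = {}"
      using False by (auto simp: skew_diagram_def dest: order_trans)
    then have "col_heights k lam j = 0" using H[OF assms(2)] by simp
    then show ?thesis using False unfolding conj part_map by simp
  qed
qed

section \<open>The order ideal\<close>

lemma column_Cons: "column (x # xs) t = column xs t + (if t \<le> x then 1 else 0)"
  by (simp add: column_def)

text \<open>
  The bound says that all ordinary hook-lengths are at most k, hence nothing is indented and the
  k-skew diagram is the ordinary diagram.
\<close>

lemma col_heights_unshifted:
  assumes "set xs \<subseteq> {..b}" and "b + length xs \<le> Suc k" and "1 \<le> j"
  shows "col_heights k xs j = column xs j"
  using assms
proof (induction xs arbitrary: j)
  case Nil
  then show ?case by (simp add: column_def)
next
  case (Cons x xs)
  have "col_heights k xs 1 \<le> length xs"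
    using Cons column_le_length[of xs 1] by simp
  then have "x + col_heights k xs (Suc 0) \<le> k"
    using Cons.prems by simp
  then have "shift k (col_heights k xs) x = 0"
    unfolding shift_def by (intro Least_equality) auto
  then show ?case using Cons by (simp add: column_Cons)
qed

lemma col_heights_append: "col_heights k ys j \<le> col_heights k (xs @ ys) j"
  by (induction xs) auto

definition partitions_in_box :: "nat \<Rightarrow> nat \<Rightarrow> nat list set" where
  "partitions_in_box n m = {xs. is_partition xs \<and> length xs \<le> n \<and> set xs \<subseteq> {..m}}"

text \<open>The order ideal generated by (m^n), for p = k + 1 - m.\<close>

definition near_rectangles :: "nat \<Rightarrow> nat \<Rightarrow> nat \<Rightarrow> nat list set" where
  "near_rectangles p n m = {xs \<in> partitions_in_box n m. length (filter (\<lambda>x. x < m) xs) \<le> p}"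

text \<open>
  A column of length c is chopped into pieces of height p and a remainder; (c + p - v) div p is the
  number of pieces of height at least v. The heights are sorted, so column j has height at least v
  exactly if j is at most the number of such pieces.

  In the induction, a further row of length m raises every ordinary column by one. This turns the
  count for v into the previous count for v - 1. In the k-skew diagram, the row is placed directly
  after the columns of full height p and covers all columns that are nonempty but not full.
\<close>

lemma col_heights_near_rectangle:
  assumes "1 \<le> p" and "1 \<le> m" and k: "Suc k = m + p"
    and "is_partition xs" and "set xs \<subseteq> {..m}" and "length (filter (\<lambda>x. x < m) xs) \<le> p"
    and "1 \<le> j"
  shows "col_heights k xs j \<le> p \<and>
    (\<forall>v. 1 \<le> v \<longrightarrow> v \<le> p \<longrightarrow>
       (v \<le> col_heights k xs j \<longleftrightarrow> j \<le> (\<Sum>t=1..m. (column xs t + p - v) div p)))"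
  using assms(4-7)
proof (induction xs arbitrary: j)
  case Nil
  then show ?case
    using assms(1) by (auto simp: column_def)
next
  case (Cons x xs)
  let ?h = "col_heights k xs"
  let ?C = "\<lambda>ys v. \<Sum>t=1..m. (column ys t + p - v) div p"
  show ?case
  proof (cases "x = m")
    case True
    have prems: "is_partition xs" "set xs \<subseteq> {..m}" "length (filter (\<lambda>x. x < m) xs) \<le> p"
      using Cons.prems(1-3) True by (auto simp: is_partition_Cons)
    have hp: "?h j \<le> p" if "1 \<le> j" for j
      using Cons.IH[OF prems that] by blast
    have hC: "v \<le> ?h j \<longleftrightarrow> j \<le> ?C xs v" if "1 \<le> j" "1 \<le> v" "v \<le> p" for j v
      using Cons.IH[OF prems that(1)] that by blast
    \<comment> \<open>The hook bound for a row of length m is a column height of at most k - m = p - 1.\<close>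
    have "shift k ?h x = ?C xs p"
      unfolding shift_def
    proof (rule Least_equality)
      have "\<not> p \<le> ?h (Suc (?C xs p))" using hC[of "Suc (?C xs p)" p] assms(1) by simp
      then show "x + ?h (Suc (?C xs p)) \<le> k" using True k by simp
    next
      fix r assume "x + ?h (Suc r) \<le> k"
      then have "\<not> p \<le> ?h (Suc r)" using True k by simp
      then show "?C xs p \<le> r" using hC[of "Suc r" p] assms(1) by simp
    qed
    then have h': "col_heights k (x # xs) j = ?h j + (if ?C xs p < j \<and> j \<le> ?C xs p + m then 1 else 0)" for j
      using True by simp
    have col': "column (x # xs) t = Suc (column xs t)" if "t \<in> {1..m}" for t
      using that True by (simp add: column_Cons)
    have C_Suc: "?C (x # xs) v = ?C xs (v - 1)" if "1 \<le> v" for v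
      using that by (intro sum.cong) (auto simp: col')
    have C_1: "?C (x # xs) 1 = ?C xs p + m"
    proof -
      have "?C (x # xs) 1 = (\<Sum>t=1..m. column xs t div p + 1)"
        using assms(1) by (intro sum.cong) (auto simp: col')
      then show ?thesis by (subst (asm) sum.distrib) simp
    qed
    have C_anti: "?C xs w \<le> ?C xs v" if "v \<le> w" for v w
      using that by (intro sum_mono div_le_mono) simp
    \<comment> \<open>Each ordinary column has at most one piece of height less than p, so at most m columns of the
      k-skew diagram are nonempty but not full.\<close>
    have "?C xs 1 \<le> (\<Sum>t=1..m. column xs t div p + 1)"
    proof (rule sum_mono)
      fix t
      have "(column xs t + p - 1) div p \<le> (column xs t + p) div p"
        by (rule div_le_mono) simp
      then show "(column xs t + p - 1) div p \<le> column xs t div p + 1"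
        using assms(1) by simp
    qed
    then have C1_le: "?C xs 1 \<le> ?C xs p + m"
      by (subst (asm) sum.distrib) simp
    have "col_heights k (x # xs) j \<le> p"
      using hp[OF Cons.prems(4)] hC[of j p] assms(1) Cons.prems(4) h'[of j] by auto
    moreover have "v \<le> col_heights k (x # xs) j \<longleftrightarrow> j \<le> ?C (x # xs) v" if v: "1 \<le> v" "v \<le> p" for v
    proof (cases "v = 1")
      case True
      have "1 \<le> ?h j" if "j \<le> ?C xs p"
        using hC[of j p] that assms(1) Cons.prems(4) by simp
      moreover have "\<not> 1 \<le> ?h j" if "\<not> j \<le> ?C xs p + m"
        using hC[of j 1] that assms(1) Cons.prems(4) C1_le by simp
      ultimately show ?thesis unfolding True C_1 h'[of j] by auto
    next
      case False
      define w where "w = v - 1"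
      have w: "1 \<le> w" "v = Suc w" "w \<le> p" using v False by (auto simp: w_def)
      have "p \<le> ?h j" "j \<le> ?C xs w" if "j \<le> ?C xs p"
        using hC[of j p] that assms(1) Cons.prems(4) C_anti[OF w(3)] by auto
      moreover have "\<not> w \<le> ?h j" "\<not> j \<le> ?C xs w" if "\<not> j \<le> ?C xs p + m"
        using hC[of j w] that w Cons.prems(4) C1_le C_anti[OF w(1)] by auto
      moreover have "w \<le> ?h j \<longleftrightarrow> j \<le> ?C xs w"
        using hC[of j w] w Cons.prems(4) by blast
      ultimately show ?thesis
        using v w unfolding C_Suc[OF v(1)] h'[of j] w_def[symmetric] by auto
    qed
    ultimately show ?thesis by blast
  next
    case False
    \<comment> \<open>All parts are smaller than m, so there are at most p of them and every ordinary column is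
      a single piece.\<close>
    let ?ys = "x # xs"
    have small: "set ?ys \<subseteq> {..m - 1}"
      using False Cons.prems by (auto simp: is_partition_Cons)
    then have "filter (\<lambda>x. x < m) ?ys = ?ys"
      using assms(2) by (intro filter_True) (auto simp del: filter.simps)
    then have len: "length ?ys \<le> p" using Cons.prems(3) by metis
    have h: "col_heights k ?ys j = column ?ys j"
      using small len k assms(2) Cons.prems(4) by (intro col_heights_unshifted[of _ "m - 1"]) auto
    have col_le: "column ?ys t \<le> p" for t
      using column_le_length[of ?ys t] len by simp
    have "v \<le> column ?ys j \<longleftrightarrow> j \<le> ?C ?ys v" if v: "1 \<le> v" "v \<le> p" for v
    proof -
      have iff: "v \<le> column ?ys t \<longleftrightarrow> t \<le> part ?ys v" if "1 \<le> t" for t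
        using le_column_iff[OF Cons.prems(1) v(1), of t] part_gt_length[of ?ys v] that by linarith
      have "(column ?ys t + p - v) div p = (if v \<le> column ?ys t then 1 else 0)" for t
      proof (cases "v \<le> column ?ys t")
        case True
        then obtain d where d: "column ?ys t = v + d" by (metis le_iff_add)
        moreover have "d < p" using d col_le[of t] v by linarith
        ultimately show ?thesis by (simp add: add.commute)
      qed (use v in simp)
      then have "?C ?ys v = card {t \<in> {1..m}. v \<le> column ?ys t}"
        by (simp add: sum.If_cases Int_def)
      also have "{t \<in> {1..m}. v \<le> column ?ys t} = {1..part ?ys v}"
      proof (intro set_eqI iffI)
        fix t assume "t \<in> {1..part ?ys v}"
        then show "t \<in> {t \<in> {1..m}. v \<le> column ?ys t}"
          using iff[of t] part_le_bound[OF Cons.prems(2), of v] by (metis atLeastAtMost_iff le_trans mem_Collect_eq)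
      next
        fix t assume "t \<in> {t \<in> {1..m}. v \<le> column ?ys t}"
        then show "t \<in> {1..part ?ys v}"
          using iff[of t] by (metis (no_types, lifting) atLeastAtMost_iff mem_Collect_eq)
      qed
      finally have "?C ?ys v = part ?ys v" by (simp only: card_atLeastAtMost diff_Suc_1 One_nat_def)
      then show ?thesis using iff[OF Cons.prems(4)] by (simp only:)
    qed
    then show ?thesis using h col_le by simp
  qed
qed

lemma near_rectangles_bounded:
  "m \<le> k \<Longrightarrow> near_rectangles p n m \<subseteq> bounded_partitions k"
  by (auto simp: near_rectangles_def partitions_in_box_def bounded_partitions_eq)

text \<open>
  This fails for general k-bounded partitions. Here it holds because the numbers of pieces grow
  with the ordinary columns.
\<close>

lemma k_conjugate_mono_near_rectangles:
  assumes p: "1 \<le> p" and m: "1 \<le> m" and k: "Suc k = m + p"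
    and lam: "lam \<in> near_rectangles p n m" and mu: "mu \<in> near_rectangles p n m"
    and sub: "contained lam mu"
  shows "contained (k_conjugate k lam) (k_conjugate k mu)"
  unfolding contained_def
proof (intro allI impI)
  fix j :: nat assume j: "1 \<le> j"
  let ?C = "\<lambda>ys v. \<Sum>t=1..m. (column ys t + p - v) div p"
  have nr: "is_partition xs" "set xs \<subseteq> {..m}" "length (filter (\<lambda>x. x < m) xs) \<le> p"
    if "xs \<in> near_rectangles p n m" for xs
    using that by (auto simp: near_rectangles_def partitions_in_box_def)
  have H: "col_heights k xs j \<le> p \<and>
    (\<forall>v. 1 \<le> v \<longrightarrow> v \<le> p \<longrightarrow> (v \<le> col_heights k xs j \<longleftrightarrow> j \<le> ?C xs v))"
    if "xs \<in> near_rectangles p n m" for xs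
    using col_heights_near_rectangle[OF p m k nr[OF that] j] .
  have C: "?C lam v \<le> ?C mu v" for v
    using contained_column[OF nr(1)[OF lam] nr(1)[OF mu] sub]
    by (intro sum_mono div_le_mono diff_le_mono add_right_mono)
  have "col_heights k lam j \<le> col_heights k mu j"
  proof (cases "col_heights k lam j = 0")
    case False
    let ?v = "col_heights k lam j"
    have v: "1 \<le> ?v" "?v \<le> p" using False H[OF lam] by auto
    have "j \<le> ?C lam ?v" using H[OF lam] v by blast
    then have "j \<le> ?C mu ?v" using C order_trans by blast
    then show ?thesis using H[OF mu] v by blast
  qed simp
  moreover have "m \<le> k" using p k by simp
  ultimately show "part (k_conjugate k lam) j \<le> part (k_conjugate k mu) j"
    using part_k_conjugate[OF _ j] near_rectangles_bounded lam mu by (metis subsetD)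
qed

text \<open>
  With more than p parts smaller than m, the top p + 1 rows have ordinary hook-lengths at most
  (m - 1) + p = k, so none of them is indented and the first column of the k-skew diagram has height
  at least p + 1. The k-conjugate is then not contained in that of a near rectangle.
\<close>

lemma near_rectangle_of_cover:
  assumes p: "1 \<le> p" and m: "1 \<le> m" and k: "Suc k = m + p"
    and mu: "mu \<in> near_rectangles p n m" and cover: "k_cover k lam mu"
  shows "lam \<in> near_rectangles p n m"
proof -
  have lam: "is_partition lam" "contained lam mu" "lam \<in> bounded_partitions k" "mu \<in> bounded_partitions k"
    using cover by (auto simp: k_cover_def bounded_partitions_eq)
  have mu': "is_partition mu" "length mu \<le> n" "set mu \<subseteq> {..m}" "length (filter (\<lambda>x. x < m) mu) \<le> p"
    using mu by (auto simp: near_rectangles_def partitions_in_box_def)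
  have len: "length lam \<le> n"
    using contained_length[OF lam(1,2)] mu'(2) by simp
  have le_m: "x \<le> m" if x: "x \<in> set lam" for x
  proof -
    obtain i where "i < length lam" "x = lam ! i" using x by (auto simp: in_set_conv_nth)
    then have "x = part lam (Suc i)" by (simp add: part_def)
    also have "\<dots> \<le> part mu (Suc i)" using lam(2) by (simp add: contained_def)
    finally show ?thesis using part_le_bound[OF mu'(3), of "Suc i"] by simp
  qed
  have "length (filter (\<lambda>x. x < m) lam) \<le> p"
  proof (rule ccontr)
    assume many: "\<not> length (filter (\<lambda>x. x < m) lam) \<le> p"
    define zs where "zs = drop (length lam - Suc p) lam"
    define ys where "ys = take (length lam - Suc p) lam"
    have split: "lam = ys @ zs" by (simp add: ys_def zs_def)
    have "Suc p \<le> length lam"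
      using many length_filter_le[of "\<lambda>x. x < m" lam] by linarith
    then have len_zs: "length zs = Suc p" by (simp add: zs_def)
    have small: "z \<le> m - 1" if z: "z \<in> set zs" for z
    proof (rule ccontr)
      assume "\<not> z \<le> m - 1"
      then have "m \<le> z" using m by simp
      moreover have "\<forall>y\<in>set ys. z \<le> y"
        using lam(1) z by (auto simp: split is_partition_append)
      ultimately have "filter (\<lambda>x. x < m) ys = []"
        by (force simp: filter_empty_conv)
      moreover have "length (filter (\<lambda>x. x < m) zs) < length zs"
        using z \<open>m \<le> z\<close> by (intro length_filter_less) auto
      ultimately show False using many len_zs by (simp add: split)
    qed
    have "col_heights k zs 1 = column zs 1"
      using small k m len_zs by (intro col_heights_unshifted[of _ "m - 1"]) auto
    also have "\<dots> = Suc p"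
    proof -
      have "\<forall>z\<in>set zs. 1 \<le> z"
        using lam(1) by (auto simp: split is_partition_def Suc_le_eq)
      then show ?thesis using len_zs by (simp add: column_def)
    qed
    finally have "Suc p \<le> col_heights k lam 1"
      using col_heights_append[of k zs 1 ys] by (simp add: split)
    also have "\<dots> = part (k_conjugate k lam) 1"
      using lam(3) by (simp add: part_k_conjugate)
    also have "\<dots> \<le> part (k_conjugate k mu) 1"
      using cover by (simp add: k_cover_def contained_def)
    also have "\<dots> = col_heights k mu 1"
      using lam(4) by (simp add: part_k_conjugate)
    also have "\<dots> \<le> p"
      using col_heights_near_rectangle[OF p m k mu'(1,3,4), of 1] by simp
    finally show False by simp
  qed
  then show ?thesis
    using lam(1) len le_m by (auto simp: near_rectangles_def partitions_in_box_def)
qed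

lemma partition_split_at_max:
  assumes "is_partition xs" and "set xs \<subseteq> {..m}"
  obtains a ys where "xs = replicate a m @ ys" and "set ys \<subseteq> {..<m}" and "is_partition ys"
    and "filter (\<lambda>x. x < m) xs = ys"
proof -
  have "\<exists>a ys. xs = replicate a m @ ys \<and> set ys \<subseteq> {..<m} \<and> is_partition ys"
    using assms
  proof (induction xs)
    case Nil
    then show ?case by (intro exI[of _ 0] exI[of _ "[]"]) simp
  next
    case (Cons x xs)
    show ?case
    proof (cases "x = m")
      case True
      then obtain a ys where "xs = replicate a m @ ys" "set ys \<subseteq> {..<m}" "is_partition ys"
        using Cons by (auto simp: is_partition_Cons)
      then show ?thesis using True by (intro exI[of _ "Suc a"] exI[of _ ys]) simp
    next
      case False
      then show ?thesis using Cons.prems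
        by (intro exI[of _ 0] exI[of _ "x # xs"]) (auto simp: is_partition_Cons)
    qed
  qed
  then obtain a ys where ys: "xs = replicate a m @ ys" "set ys \<subseteq> {..<m}" "is_partition ys" by blast
  moreover have "filter (\<lambda>x. x < m) xs = ys"
    using ys by (auto simp: filter_id_conv)
  ultimately show ?thesis using that by blast
qed

lemma contained_append: "contained (xs @ ys) (xs @ zs)" if "contained ys zs"
  unfolding contained_def
proof (intro allI impI)
  fix i :: nat assume i: "1 \<le> i"
  show "part (xs @ ys) i \<le> part (xs @ zs) i"
  proof (cases "i \<le> length xs")
    case True
    then show ?thesis using i by (cases i) (auto simp: part_def nth_append)
  next
    case False
    have *: "part (xs @ us) i = part us (i - length xs)" for us
      using False by (auto simp: part_def nth_append)
    show ?thesis using that False unfolding * by (simp add: contained_def)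
  qed
qed

text \<open>
  The first part smaller than m can always be enlarged, and a new part 1 can be appended when there
  is no such part; neither creates more than p parts smaller than m, as p is positive.
\<close>

lemma near_rectangle_step:
  assumes p: "1 \<le> p" and m: "1 \<le> m"
    and lam: "lam \<in> near_rectangles p n m" and neq: "lam \<noteq> replicate n m"
  obtains mu where "mu \<in> near_rectangles p n m" and "contained lam mu"
    and "sum_list mu = Suc (sum_list lam)"
proof -
  have lam': "is_partition lam" "length lam \<le> n" "set lam \<subseteq> {..m}" "length (filter (\<lambda>x. x < m) lam) \<le> p"
    using lam by (auto simp: near_rectangles_def partitions_in_box_def)
  obtain a ys where ys: "lam = replicate a m @ ys" "set ys \<subseteq> {..<m}" "is_partition ys"
    "filter (\<lambda>x. x < m) lam = ys"
    using partition_split_at_max[OF lam'(1,3)] by metis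
  have rep: "is_partition (replicate a m)" using m by (intro is_partition_replicate) simp
  show ?thesis
  proof (cases ys)
    case Nil
    then have "a < n" using neq lam'(2) ys(1) by (cases "a = n") auto
    show ?thesis
    proof (rule that)
      show "replicate a m @ [1] \<in> near_rectangles p n m"
        using rep \<open>a < n\<close> m p
        by (auto simp: near_rectangles_def partitions_in_box_def is_partition_append
            is_partition_Cons is_partition_def[of "[]"])
      show "contained lam (replicate a m @ [1])"
        using contained_append[of "[]" "[1]" "replicate a m"] by (simp add: ys(1) Nil contained_def)
    qed (simp add: ys(1) Nil)
  next
    case (Cons y zs)
    have y: "y < m" "set zs \<subseteq> {..y}" "is_partition zs" using ys(2,3) Cons by (auto simp: is_partition_Cons)
    show ?thesis
    proof (rule that)
      have "length (filter (\<lambda>x. x < m) zs) \<le> length zs" by simp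
      then show "replicate a m @ Suc y # zs \<in> near_rectangles p n m"
        using rep y lam'(2,4) ys Cons
        by (auto simp: near_rectangles_def partitions_in_box_def is_partition_append
            is_partition_Cons)
      have "contained (y # zs) (Suc y # zs)"
        by (auto simp: contained_def part_def nth_Cons')
      then show "contained lam (replicate a m @ Suc y # zs)"
        by (simp add: ys(1) Cons contained_append)
    qed (simp add: ys(1) Cons)
  qed
qed

lemma L_ideal_eq_near_rectangles:
  assumes p: "1 \<le> p" and m: "1 \<le> m" and k: "Suc k = m + p"
  shows "L_ideal k m n = near_rectangles p n m"
proof
  have mk: "m \<le> k" using p k by simp
  have top: "replicate n m \<in> near_rectangles p n m"
    using m is_partition_replicate[of m n] by (auto simp: near_rectangles_def partitions_in_box_def)
  have "lam \<in> near_rectangles p n m" if "(k_cover k)\<^sup>*\<^sup>* lam (replicate n m)" for lam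
    using that
    by (induction rule: converse_rtranclp_induct) (use top near_rectangle_of_cover[OF p m k] in blast)+
  then show "L_ideal k m n \<subseteq> near_rectangles p n m"
    by (auto simp: L_ideal_def k_le_def)
  have "(k_cover k)\<^sup>*\<^sup>* lam (replicate n m)" if "lam \<in> near_rectangles p n m" for lam
    using that
  proof (induction "n * m - sum_list lam" arbitrary: lam rule: less_induct)
    case less
    show ?case
    proof (cases "lam = replicate n m")
      case False
      then obtain mu where mu: "mu \<in> near_rectangles p n m" "contained lam mu"
        "sum_list mu = Suc (sum_list lam)"
        using near_rectangle_step[OF p m less.prems] by blast
      have "sum_list xs \<le> length xs * m" if "set xs \<subseteq> {..m}" for xs
        using that by (induction xs) auto
      then have "sum_list mu \<le> length mu * m" "length mu \<le> n"
        using mu(1) by (auto simp: near_rectangles_def partitions_in_box_def)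
      then have "sum_list mu \<le> n * m"
        using mult_le_mono1 order_trans by blast
      then have "(k_cover k)\<^sup>*\<^sup>* mu (replicate n m)"
        using mu by (intro less.hyps) auto
      with _ show ?thesis
      proof (rule converse_rtranclp_into_rtranclp)
        show "k_cover k lam mu"
          using mu less.prems near_rectangles_bounded[OF mk]
            k_conjugate_mono_near_rectangles[OF p m k less.prems mu(1,2)]
          by (auto simp: k_cover_def)
      qed
    qed simp
  qed
  then show "near_rectangles p n m \<subseteq> L_ideal k m n"
    using near_rectangles_bounded[OF mk] by (auto simp: L_ideal_def k_le_def)
qed

section \<open>Counting near rectangles by degree\<close>

definition degree_gf :: "nat list set \<Rightarrow> rat fps" where
  "degree_gf A = Abs_fps (\<lambda>i. of_nat (card {xs \<in> A. sum_list xs = i}))"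

lemma degree_gf_Un:
  assumes "finite A" and "finite B" and "A \<inter> B = {}"
  shows "degree_gf (A \<union> B) = degree_gf A + degree_gf B"
proof (rule fps_ext)
  fix i
  have "{xs \<in> A \<union> B. sum_list xs = i} = {xs \<in> A. sum_list xs = i} \<union> {xs \<in> B. sum_list xs = i}"
    by blast
  moreover have "card \<dots> = card {xs \<in> A. sum_list xs = i} + card {xs \<in> B. sum_list xs = i}"
    using assms by (intro card_Un_disjoint) auto
  ultimately show "fps_nth (degree_gf (A \<union> B)) i = fps_nth (degree_gf A + degree_gf B) i"
    by (simp add: degree_gf_def)
qed

lemma degree_gf_append: "degree_gf ((@) cs ` A) = fps_X ^ sum_list cs * degree_gf A"
proof (rule fps_ext)
  fix i
  have "{xs \<in> (@) cs ` A. sum_list xs = i} =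
      (if i < sum_list cs then {} else (@) cs ` {xs \<in> A. sum_list xs = i - sum_list cs})"
    by auto
  then show "fps_nth (degree_gf ((@) cs ` A)) i = fps_nth (fps_X ^ sum_list cs * degree_gf A) i"
    by (simp add: degree_gf_def fps_X_power_mult_nth card_image inj_on_def)
qed

lemma finite_partitions_in_box [simp]: "finite (partitions_in_box n m)"
  by (rule finite_subset[OF _ finite_lists_length_le[of "{..m}" n]])
     (auto simp: partitions_in_box_def)

lemma degree_gf_singleton_Nil: "degree_gf {[]} = 1"
proof (rule fps_ext)
  fix i
  have "{xs \<in> {[]}. sum_list xs = i} = (if i = 0 then {[] :: nat list} else {})" by auto
  then show "fps_nth (degree_gf {[]}) i = fps_nth 1 i" by (simp add: degree_gf_def)
qed

lemma partitions_in_box_0_left: "partitions_in_box 0 m = {[]}"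
  by (auto simp: partitions_in_box_def is_partition_def)

lemma partitions_in_box_0_right: "partitions_in_box n 0 = {[]}"
proof -
  have "xs \<in> partitions_in_box n 0 \<longleftrightarrow> xs = []" for xs
    by (cases xs) (auto simp: partitions_in_box_def is_partition_def)
  then show ?thesis by blast
qed

lemma partitions_in_box_Suc:
  "partitions_in_box (Suc n) (Suc m) =
     partitions_in_box (Suc n) m \<union> (@) [Suc m] ` partitions_in_box n (Suc m)"
proof (intro set_eqI)
  fix xs
  show "xs \<in> partitions_in_box (Suc n) (Suc m) \<longleftrightarrow>
     xs \<in> partitions_in_box (Suc n) m \<union> (@) [Suc m] ` partitions_in_box n (Suc m)"
  proof (cases "xs \<noteq> [] \<and> hd xs = Suc m")
    case True
    then obtain ys where ys: "xs = Suc m # ys" by (cases xs) auto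
    have "xs \<in> partitions_in_box (Suc n) (Suc m) \<longleftrightarrow> ys \<in> partitions_in_box n (Suc m)"
      by (auto simp: ys partitions_in_box_def is_partition_Cons)
    moreover have "xs \<notin> partitions_in_box (Suc n) m"
      by (simp add: ys partitions_in_box_def)
    moreover have "xs \<in> (@) [Suc m] ` partitions_in_box n (Suc m) \<longleftrightarrow> ys \<in> partitions_in_box n (Suc m)"
      by (auto simp: ys)
    ultimately show ?thesis by blast
  next
    case False
    then have "xs \<notin> (@) [Suc m] ` partitions_in_box n (Suc m)" by auto
    moreover have "set xs \<subseteq> {..Suc m} \<longleftrightarrow> set xs \<subseteq> {..m}" if "is_partition xs"
      using False that by (cases xs) (auto simp: is_partition_Cons le_Suc_eq)
    ultimately show ?thesis by (auto simp: partitions_in_box_def)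
  qed
qed

lemma prod_shift_first:
  fixes f :: "nat \<Rightarrow> 'a :: comm_monoid_mult"
  shows "(\<Prod>i=1..Suc m. f (n + i)) = f (Suc n) * (\<Prod>i=1..m. f (Suc n + i))"
  by (induction m) (simp_all add: mult.assoc)

text \<open>
  The q-Pascal rule: either the largest possible part occurs, and is removed, or it does not.
  Multiplied by the denominators, both sides of the rule are multiples of one common product.
\<close>

lemma degree_gf_partitions_in_box:
  "degree_gf (partitions_in_box n m) * (\<Prod>i=1..m. 1 - fps_X ^ i) = (\<Prod>i=1..m. 1 - fps_X ^ (n + i))"
proof (induction m arbitrary: n)
  case 0
  then show ?case by (simp add: partitions_in_box_0_right degree_gf_singleton_Nil)
next
  case (Suc m)
  let ?D = "\<lambda>m. \<Prod>i=1..m. 1 - fps_X ^ i :: rat fps"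
  let ?U = "\<lambda>n m. \<Prod>i=1..m. 1 - fps_X ^ (n + i) :: rat fps"
  note IH = Suc.IH
  show ?case
  proof (induction n)
    case 0
    then show ?case by (simp add: partitions_in_box_0_left degree_gf_singleton_Nil)
  next
    case (Suc n)
    have "degree_gf (partitions_in_box (Suc n) (Suc m)) =
        degree_gf (partitions_in_box (Suc n) m) + fps_X ^ Suc m * degree_gf (partitions_in_box n (Suc m))"
    proof -
      have "partitions_in_box (Suc n) m \<inter> (@) [Suc m] ` partitions_in_box n (Suc m) = {}"
        by (auto simp: partitions_in_box_def)
      then show ?thesis
        unfolding partitions_in_box_Suc using degree_gf_append[of "[Suc m]"]
        by (simp add: degree_gf_Un)
    qed
    then have "degree_gf (partitions_in_box (Suc n) (Suc m)) * ?D (Suc m) =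
        (degree_gf (partitions_in_box (Suc n) m) * ?D m) * (1 - fps_X ^ Suc m) +
        fps_X ^ Suc m * (degree_gf (partitions_in_box n (Suc m)) * ?D (Suc m))"
      by (simp add: algebra_simps)
    also have "\<dots> = ?U (Suc n) m * (1 - fps_X ^ Suc m) + fps_X ^ Suc m * ?U n (Suc m)"
      by (simp only: Suc.IH IH)
    also have "\<dots> = ?U (Suc n) m * (1 - fps_X ^ Suc m) + fps_X ^ Suc m * ((1 - fps_X ^ Suc n) * ?U (Suc n) m)"
      by (simp only: prod_shift_first[of "\<lambda>i. 1 - fps_X ^ i" n m])
    also have "\<dots> = ?U (Suc n) m * (1 - fps_X ^ (Suc n + Suc m))"
      by (simp add: algebra_simps power_add)
    also have "\<dots> = ?U (Suc n) (Suc m)" by simp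
    finally show ?case .
  qed
qed

lemma one_minus_fps_X_power_nonzero: "0 < i \<Longrightarrow> 1 - fps_X ^ i \<noteq> (0 :: rat fps)"
proof
  assume "0 < i" and "1 - fps_X ^ i = (0 :: rat fps)"
  then have "fps_nth (1 - fps_X ^ i :: rat fps) 0 = 0" by (simp only: fps_zero_nth)
  then show False using \<open>0 < i\<close> by simp
qed

lemma gaussian_denominator_nonzero: "(\<Prod>i=1..m. 1 - fps_X ^ i) \<noteq> (0 :: rat fps)"
proof -
  have "\<forall>i\<in>{1..m}. 1 - fps_X ^ i \<noteq> (0 :: rat fps)"
    by (intro ballI one_minus_fps_X_power_nonzero) simp
  then show ?thesis by (simp only: prod_zero_iff finite_atLeastAtMost) blast
qed

lemma gaussian_eq_degree_gf: "gaussian (n + m) m = degree_gf (partitions_in_box n m)"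
  unfolding gaussian_def add_diff_cancel_right' degree_gf_partitions_in_box[symmetric]
  by (rule nonzero_mult_div_cancel_right[OF gaussian_denominator_nonzero])

text \<open>What remains of a near rectangle with more than p parts when leading parts m are removed
  until p parts are left.\<close>

definition full_partitions :: "nat \<Rightarrow> nat \<Rightarrow> nat list set" where
  "full_partitions p m = {xs \<in> partitions_in_box p m. length xs = p}"

text \<open>
  Removing one cell from each of the p parts leaves a partition in a box of width m - 1. The proof
  obtains the corresponding identity as the other q-Pascal rule, from the difference of the box
  counts for p and p - 1 rows.
\<close>

lemma degree_gf_full_partitions:
  assumes "1 \<le> p" and "1 \<le> m"
  shows "degree_gf (full_partitions p m) = fps_X ^ p * gaussian (p + m - 1) (m - 1)"
proof -
  obtain q l where q: "p = Suc q" and l: "m = Suc l"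
    using assms by (metis Suc_le_D One_nat_def)
  let ?D = "\<lambda>m. \<Prod>i=1..m. 1 - fps_X ^ i :: rat fps"
  let ?U = "\<lambda>n m. \<Prod>i=1..m. 1 - fps_X ^ (n + i) :: rat fps"
  have "partitions_in_box p m = partitions_in_box q m \<union> full_partitions p m"
    by (auto simp: partitions_in_box_def full_partitions_def q)
  moreover have "finite (full_partitions p m)"
    by (simp add: full_partitions_def)
  moreover have "partitions_in_box q m \<inter> full_partitions p m = {}"
    by (auto simp: partitions_in_box_def full_partitions_def q)
  ultimately have "degree_gf (partitions_in_box p m) =
      degree_gf (partitions_in_box q m) + degree_gf (full_partitions p m)"
    by (simp add: degree_gf_Un)
  then have "degree_gf (full_partitions p m) * ?D m = ?U p m - ?U q m"
    using degree_gf_partitions_in_box[of p m] degree_gf_partitions_in_box[of q m]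
    by (simp add: algebra_simps)
  also have "\<dots> = ?U p m - (1 - fps_X ^ p) * ?U p l"
    unfolding q l by (simp only: prod_shift_first[of "\<lambda>i. 1 - fps_X ^ i" q l])
  also have "\<dots> = fps_X ^ p * ?U p l * (1 - fps_X ^ m)"
    by (simp add: l algebra_simps power_add)
  also have "\<dots> = fps_X ^ p * degree_gf (partitions_in_box p l) * ?D m"
    using degree_gf_partitions_in_box[of p l] by (simp add: l mult.assoc)
  finally have "degree_gf (full_partitions p m) = fps_X ^ p * degree_gf (partitions_in_box p l)"
    by (rule mult_right_cancel[OF gaussian_denominator_nonzero[of m], THEN iffD1])
  then show ?thesis using gaussian_eq_degree_gf[of p l] by (simp add: l)
qed

text \<open>
  A near rectangle with n + 1 parts has at most p parts smaller than m, so its first n + 1 - p parts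
  are equal to m.
\<close>

lemma near_rectangles_Suc:
  assumes p: "p \<le> n" and m: "1 \<le> m"
  shows "near_rectangles p (Suc n) m =
    near_rectangles p n m \<union> (@) (replicate (Suc n - p) m) ` full_partitions p m"
proof (intro equalityI subsetI)
  fix xs assume xs: "xs \<in> near_rectangles p (Suc n) m"
  then have part: "is_partition xs" "set xs \<subseteq> {..m}" "length (filter (\<lambda>x. x < m) xs) \<le> p" "length xs \<le> Suc n"
    by (auto simp: near_rectangles_def partitions_in_box_def)
  show "xs \<in> near_rectangles p n m \<union> (@) (replicate (Suc n - p) m) ` full_partitions p m"
  proof (cases "length xs = Suc n")
    case True
    obtain a ys where ys: "xs = replicate a m @ ys" "filter (\<lambda>x. x < m) xs = ys"
      using partition_split_at_max[OF part(1,2)] by metis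
    then have a: "a + length ys = Suc n" "length ys \<le> p"
      using True part(3) by (metis length_append length_replicate) (use ys part in simp)
    then have "Suc n - p \<le> a" by simp
    then obtain d where d: "a = (Suc n - p) + d" by (metis le_iff_add)
    have eq: "xs = replicate (Suc n - p) m @ (replicate d m @ ys)"
      unfolding ys(1) d replicate_add by simp
    have "replicate d m @ ys \<in> full_partitions p m"
      using part(1,2) a d p
      by (auto simp: full_partitions_def partitions_in_box_def eq is_partition_append)
    then show ?thesis using eq by blast
  next
    case False
    then show ?thesis using xs part(4) by (auto simp: near_rectangles_def partitions_in_box_def)
  qed
next
  fix xs assume "xs \<in> near_rectangles p n m \<union> (@) (replicate (Suc n - p) m) ` full_partitions p m"
  then show "xs \<in> near_rectangles p (Suc n) m"
  proof
    assume "xs \<in> (@) (replicate (Suc n - p) m) ` full_partitions p m"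
    then obtain ys where ys: "xs = replicate (Suc n - p) m @ ys" "is_partition ys" "length ys = p" "set ys \<subseteq> {..m}"
      by (auto simp: full_partitions_def partitions_in_box_def)
    have "is_partition (replicate (Suc n - p) m)" using m by (intro is_partition_replicate) simp
    then have "is_partition xs" using ys by (auto simp: is_partition_append)
    moreover have "length (filter (\<lambda>x. x < m) xs) \<le> p"
      using ys length_filter_le[of "\<lambda>x. x < m" ys] by simp
    moreover have "length xs = Suc n" using ys p by simp
    moreover have "set xs \<subseteq> {..m}" using ys by auto
    ultimately show ?thesis by (simp add: near_rectangles_def partitions_in_box_def)
  qed (auto simp: near_rectangles_def partitions_in_box_def)
qed

lemma degree_gf_near_rectangles:
  assumes p: "1 \<le> p" and m: "1 \<le> m" and k: "Suc k = m + p"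
  shows "degree_gf (near_rectangles p (p + d) m) =
    gaussian (k + 1) m + fps_X ^ (k + 1) * (\<Sum>j<d. (fps_X ^ m) ^ j) * gaussian k (m - 1)"
proof (induction d)
  case 0
  have "near_rectangles p p m = partitions_in_box p m"
    using le_trans[OF length_filter_le] by (auto simp: near_rectangles_def partitions_in_box_def)
  then show ?case using gaussian_eq_degree_gf[of p m] k by (simp add: add.commute)
next
  case (Suc d)
  have "degree_gf (near_rectangles p (p + Suc d) m) =
    degree_gf (near_rectangles p (p + d) m) + degree_gf ((@) (replicate (Suc d) m) ` full_partitions p m)"
  proof -
    have "near_rectangles p (p + Suc d) m =
      near_rectangles p (p + d) m \<union> (@) (replicate (Suc d) m) ` full_partitions p m"
      using near_rectangles_Suc[of p "p + d" m] m by simp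
    moreover have "finite (near_rectangles p (p + d) m)" and "finite (full_partitions p m)"
      by (auto simp: near_rectangles_def full_partitions_def)
    moreover have "near_rectangles p (p + d) m \<inter> (@) (replicate (Suc d) m) ` full_partitions p m = {}"
      by (auto simp: near_rectangles_def full_partitions_def partitions_in_box_def)
    ultimately show ?thesis by (simp add: degree_gf_Un)
  qed
  also have "degree_gf ((@) (replicate (Suc d) m) ` full_partitions p m) =
      fps_X ^ (k + 1) * (fps_X ^ m) ^ d * gaussian k (m - 1)"
  proof -
    have "p + m - 1 = k" and e: "Suc d * m + p = (k + 1) + m * d" using k by auto
    then have "degree_gf ((@) (replicate (Suc d) m) ` full_partitions p m) =
        fps_X ^ (Suc d * m) * (fps_X ^ p * gaussian k (m - 1))"
      by (simp only: degree_gf_append degree_gf_full_partitions[OF p m] sum_list_replicate of_nat_id)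
    also have "\<dots> = fps_X ^ (Suc d * m + p) * gaussian k (m - 1)"
      by (simp only: power_add mult.assoc)
    finally show ?thesis unfolding e by (simp only: power_add power_mult)
  qed
  finally show ?case
    unfolding Suc.IH by (simp only: sum.lessThan_Suc distrib_left distrib_right add.assoc)
qed

theorem theorem39:
  fixes k m n i :: nat
  assumes "1 \<le> k" and "1 \<le> m" and "1 \<le> n"
    and "m \<le> k" and "k - m + 1 \<le> n"
  shows "of_nat (card {lam \<in> L_ideal k m n. sum_list lam = i}) =
    fps_nth (gaussian (k + 1) m
      + fps_X ^ (k + 1) * ((1 - fps_X ^ (m * (n + m - k - 1))) / (1 - fps_X ^ m))
        * gaussian k (m - 1)) i"
proof -
  define p where "p = Suc k - m"
  have p: "1 \<le> p" and k: "Suc k = m + p" and n: "n = p + (n + m - k - 1)"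
    using assms by (auto simp: p_def)
  define d where "d = n + m - k - 1"
  have "(1 - fps_X ^ (m * d)) = (\<Sum>j<d. (fps_X ^ m) ^ j) * (1 - fps_X ^ m :: rat fps)"
    unfolding power_mult one_diff_power_eq[of _ d] by (rule mult.commute)
  then have geometric: "(1 - fps_X ^ (m * d)) / (1 - fps_X ^ m) = (\<Sum>j<d. (fps_X ^ m) ^ j :: rat fps)"
    using one_minus_fps_X_power_nonzero[of m] assms(2) by simp
  have "of_nat (card {lam \<in> L_ideal k m n. sum_list lam = i}) = fps_nth (degree_gf (near_rectangles p (p + d) m)) i"
    using n by (simp add: L_ideal_eq_near_rectangles[OF p assms(2) k] degree_gf_def d_def)
  then show ?thesis
    by (simp only: degree_gf_near_rectangles[OF p assms(2) k] d_def[symmetric] geometric)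
qed

end
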